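(* For every positive integer $k$ there exists a finite family of strings in the plane whose disjointness graph $G$ is triangle-free and satisfies $\chi(G)\ge k$. Moreover, the strings can be chosen to be simple polygonal paths each consisting of at most $4$ segments.
   Context: A string is a continuous arc in the plane. The disjointness graph of a family of sets is the graph whose vertices are the members, two adjacent iff the corresponding sets are disjoint. $\chi$ denotes the chromatic number. *)

theory Defs
  imports "HOL-Analysis.Analysis" "HOL-Library.Ramsey" "HOL-Library.Extended_Nat"
begin

text \<open>As in \<^theory>\<open>HOL-Library.Ramsey\<close>, a graph is given by a vertex set \<open>V\<close> and a set \<open>E\<close> of
  two-element subsets of \<open>V\<close>.\<close>

definition triangle_free :: "'v set \<Rightarrow> 'v set set \<Rightarrow> bool" where
  "triangle_free V E \<longleftrightarrow> \<not> (\<exists>T\<subseteq>V. card T = 3 \<and> clique T E)"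

definition proper_colouring :: "'v set \<Rightarrow> 'v set set \<Rightarrow> nat \<Rightarrow> ('v \<Rightarrow> nat) \<Rightarrow> bool" where
  "proper_colouring V E n c \<longleftrightarrow>
     c ` V \<subseteq> {..<n} \<and> (\<forall>u\<in>V. \<forall>v\<in>V. {u, v} \<in> E \<longrightarrow> c u \<noteq> c v)"

text \<open>The value is \<open>\<infinity>\<close> if no finite number of colours suffices.\<close>

definition chromatic_number :: "'v set \<Rightarrow> 'v set set \<Rightarrow> enat" where
  "chromatic_number V E = (INF n\<in>{n. \<exists>c. proper_colouring V E n c}. enat n)"

definition disjointness_edges :: "'a set set \<Rightarrow> 'a set set set" where
  "disjointness_edges F = {{A, B} | A B. A \<in> F \<and> B \<in> F \<and> A \<noteq> B \<and> A \<inter> B = {}}"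

definition plane_string :: "(real^2) set \<Rightarrow> bool" where
  "plane_string S \<longleftrightarrow> (\<exists>\<gamma>. arc \<gamma> \<and> S = path_image \<gamma>)"

text \<open>The polygonal path through the given vertices, in order. Lists with fewer than two
  vertices have no segments; their values are irrelevant.\<close>

fun polygonal_path :: "'a::real_normed_vector list \<Rightarrow> real \<Rightarrow> 'a" where
  "polygonal_path [] = linepath 0 0"
| "polygonal_path [p] = linepath p p"
| "polygonal_path [p, q] = linepath p q"
| "polygonal_path (p # q # r # ps) = linepath p q +++ polygonal_path (q # r # ps)"

text \<open>A list of \<open>m + 1\<close> vertices yields \<open>m\<close> segments. Simplicity is injectivity of the
  parametrisation, so segments are nondegenerate, two consecutive ones share only their common
  vertex, and any other two are disjoint; in particular the path is not closed.\<close>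

definition simple_polygonal_at_most :: "nat \<Rightarrow> (real^2) set \<Rightarrow> bool" where
  "simple_polygonal_at_most n S \<longleftrightarrow>
     (\<exists>ps. 2 \<le> length ps \<and> length ps \<le> n + 1 \<and>
           arc (polygonal_path ps) \<and> S = path_image (polygonal_path ps))"

end

theory Submission
  imports Defs
begin

text \<open>
  The strings realise the shift graph: its vertices are the pairs \<open>i < j\<close> from \<open>{1..n}\<close>, and
  \<open>(i, j)\<close> is adjacent to \<open>(j, k)\<close>. It has no triangles, and in a proper colouring the sets of
  colours occurring on the pairs starting in \<open>i\<close> are pairwise distinct, so \<open>m\<close> colours force
  \<open>n \<le> 2 ^ m\<close>.

  The string of \<open>(i, j)\<close> contains the horizontal base from \<open>(2i + 1, 0)\<close> to \<open>(2j, 0)\<close>, so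
  strings of overlapping intervals meet, whereas the bases of \<open>(i, j)\<close> and \<open>(j, k)\<close> are
  separated by a gap. A long vertical segment is attached to the right end of the base. To its left
  end a hook is attached, which passes below and to the left of all bases and then crosses exactly
  those verticals that stand at \<open>x = 2j\<close> with \<open>j < i\<close>; so strings of intervals that do
  not even touch meet as well. Hooks with different \<open>i\<close> are nested, hence disjoint.
\<close>

section \<open>Segments in coordinates\<close>

lemma closed_segment_on_line:
  fixes p v :: "'a::real_vector"
  assumes "a \<le> b"
  shows "closed_segment (p + a *\<^sub>R v) (p + b *\<^sub>R v) = {p + t *\<^sub>R v | t. a \<le> t \<and> t \<le> b}"
proof -
  have "(\<lambda>t. p + t *\<^sub>R v) ` closed_segment a b
      = (+) p ` (\<lambda>t. t *\<^sub>R v) ` closed_segment a b"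
    by (simp add: image_image)
  also have "\<dots> = closed_segment (p + a *\<^sub>R v) (p + b *\<^sub>R v)"
    by (simp add: closed_segment_linear_image[symmetric] linear_scaleR_left
        closed_segment_translation)
  finally have "closed_segment (p + a *\<^sub>R v) (p + b *\<^sub>R v)
      = (\<lambda>t. p + t *\<^sub>R v) ` closed_segment a b" ..
  then show ?thesis
    using assms by (auto simp: closed_segment_eq_real_ivl)
qed

abbreviation point :: "real \<Rightarrow> real \<Rightarrow> real^2" where
  "point x y \<equiv> vector [x, y]"

lemma point_eq_iff [simp]: "point x y = point x' y' \<longleftrightarrow> x = x' \<and> y = y'"
  by (auto simp: vec_eq_iff forall_2)

text \<open>The hook consists of an outer segment on \<open>y = 2 * x + a\<close> and an inner one
  on \<open>y = x - (2 * a + 1)\<close>; the second vertex is where these lines cross. The outer one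
  stops at \<open>2 * a - 1\<close>, past \<open>x = 2 * j\<close> for integers \<open>j < a\<close>
  but short of \<open>2 * a\<close>.\<close>

definition vertices :: "real \<Rightarrow> real \<Rightarrow> real \<Rightarrow> (real^2) list" where
  "vertices h a b =
     [point (2 * a - 1) (5 * a - 2), point (- (3 * a) - 1) (- (5 * a) - 2), point (2 * a + 1) 0,
      point (2 * b) 0, point (2 * b) h]"

definition curve :: "real \<Rightarrow> real \<Rightarrow> real \<Rightarrow> (real^2) set" where
  "curve h a b = path_image (polygonal_path (vertices h a b))"

lemma outer_hook_eq:
  assumes "1 \<le> a"
  shows "closed_segment (point (2 * a - 1) (5 * a - 2)) (point (- (3 * a) - 1) (- (5 * a) - 2)) =
    {point t (2 * t + a) | t. - (3 * a) - 1 \<le> t \<and> t \<le> 2 * a - 1}"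
proof -
  have *: "point 0 a + t *\<^sub>R point 1 2 = point t (2 * t + a)" for t
    by (simp add: vec_eq_iff forall_2)
  show ?thesis
    using closed_segment_on_line[of "- (3 * a) - 1" "2 * a - 1" "point 0 a" "point 1 2"] assms
    by (simp only: *) (simp add: closed_segment_commute algebra_simps)
qed

lemma inner_hook_eq:
  assumes "1 \<le> a"
  shows "closed_segment (point (- (3 * a) - 1) (- (5 * a) - 2)) (point (2 * a + 1) 0) =
    {point (2 * a + 1 + t) t | t. - (5 * a) - 2 \<le> t \<and> t \<le> 0}"
proof -
  have *: "point (2 * a + 1) 0 + t *\<^sub>R point 1 1 = point (2 * a + 1 + t) t" for t
    by (simp add: vec_eq_iff forall_2)
  have "2 * a + 1 + (- (5 * a) - 2) = - (3 * a) - 1" "2 * a + 1 + 0 = 2 * a + 1"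
    by simp_all
  then show ?thesis
    using closed_segment_on_line[of "- (5 * a) - 2" 0 "point (2 * a + 1) 0" "point 1 1"] assms
    by (simp only: *)
qed

lemma closed_segment_horizontal:
  assumes "x \<le> x'"
  shows "closed_segment (point x y) (point x' y) = {point t y | t. x \<le> t \<and> t \<le> x'}"
proof -
  have *: "point 0 y + t *\<^sub>R point 1 0 = point t y" for t
    by (simp add: vec_eq_iff forall_2)
  show ?thesis
    using closed_segment_on_line[OF assms, of "point 0 y" "point 1 0"] by (simp only: *)
qed

lemma closed_segment_vertical:
  assumes "y \<le> y'"
  shows "closed_segment (point x y) (point x y') = {point x t | t. y \<le> t \<and> t \<le> y'}"
proof -
  have *: "point x 0 + t *\<^sub>R point 0 1 = point x t" for t
    by (simp add: vec_eq_iff forall_2)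
  show ?thesis
    using closed_segment_on_line[OF assms, of "point x 0" "point 0 1"] by (simp only: *)
qed

lemmas segment_eqs =
  outer_hook_eq inner_hook_eq closed_segment_horizontal closed_segment_vertical

lemma curve_eq:
  assumes "1 \<le> a" "a + 1 \<le> b" "0 \<le> h"
  shows "curve h a b =
    {point t (2 * t + a) | t. - (3 * a) - 1 \<le> t \<and> t \<le> 2 * a - 1} \<union>
    {point (2 * a + 1 + t) t | t. - (5 * a) - 2 \<le> t \<and> t \<le> 0} \<union>
    {point t 0 | t. 2 * a + 1 \<le> t \<and> t \<le> 2 * b} \<union>
    {point (2 * b) t | t. 0 \<le> t \<and> t \<le> h}"
proof -
  have "2 * a + 1 \<le> 2 * b" using assms by simp
  then show ?thesis
    using assms unfolding curve_def vertices_def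
    by (simp add: path_image_join segment_eqs Un_assoc)
qed

text \<open>Segments are prepended from the last one on, each meeting the rest only in its end.
  \<open>0 < h\<close> keeps the vertical nondegenerate.\<close>

lemma arc_vertices:
  assumes "1 \<le> a" "a + 1 \<le> b" "0 < h"
  shows "arc (polygonal_path (vertices h a b))"
proof -
  let ?p = "point (2 * a - 1) (5 * a - 2)" and ?q = "point (- (3 * a) - 1) (- (5 * a) - 2)"
    and ?r = "point (2 * a + 1) 0" and ?s = "point (2 * b) 0" and ?t = "point (2 * b) h"
  have ab: "2 * a + 1 \<le> 2 * b" using assms by simp
  have 1: "arc (linepath ?r ?s +++ linepath ?s ?t)"
    using assms ab
    by (intro arc_join) (auto simp: segment_eqs)
  have 2: "arc (linepath ?q ?r +++ linepath ?r ?s +++ linepath ?s ?t)"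
    using assms ab
    by (intro arc_join 1) (auto simp: segment_eqs path_image_join)
  have "arc (linepath ?p ?q +++ linepath ?q ?r +++ linepath ?r ?s +++ linepath ?s ?t)"
    using assms ab
    by (intro arc_join 2) (auto simp: segment_eqs path_image_join)
  then show ?thesis
    by (simp add: vertices_def)
qed

section \<open>Which curves meet\<close>

lemma curve_disjoint:
  assumes "1 \<le> a" "a + 1 \<le> b" "b + 1 \<le> c" "0 \<le> h"
  shows "curve h a b \<inter> curve h b c = {}"
proof -
  have "1 \<le> b" using assms by simp
  then show ?thesis
    \<comment> \<open>Equal parts of the two hooks are parallel. An outer and an inner line of
      different strings cross left of \<open>x = - (3 * a) - 1\<close>, since \<open>a < b\<close>,
      hence off the first string. The second string passes the vertical at \<open>2 * b\<close> on
      both sides: its outer hook ends at \<open>2 * b - 1\<close>, its base starts at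
      \<open>2 * b + 1\<close>.\<close>
    using assms by (auto simp: curve_eq)
qed

lemma curve_meets_of_overlap:
  assumes "1 \<le> a" "a + 1 \<le> b" "1 \<le> c" "c + 1 \<le> d" "0 \<le> h" "a + 1 \<le> d" "c + 1 \<le> b"
  shows "curve h a b \<inter> curve h c d \<noteq> {}"
proof -
  \<comment> \<open>The larger left end lies on both bases, as
    \<open>max a c + 1 \<le> min b d\<close>.\<close>
  have "point (2 * max a c + 1) 0 \<in> curve h a b \<inter> curve h c d"
    using assms by (auto simp: curve_eq)
  then show ?thesis by blast
qed

lemma curve_meets_of_gap:
  assumes "1 \<le> a" "a + 1 \<le> b" "b + 1 \<le> c" "c + 1 \<le> d" "5 * c \<le> h"
  shows "curve h a b \<inter> curve h c d \<noteq> {}"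
proof -
  \<comment> \<open>Here the outer hook of the second string, on \<open>y = 2 * x + c\<close>,
    crosses the vertical of the first; the height is below \<open>5 * c\<close>, so the vertical
    reaches it.\<close>
  have "point (2 * b) (4 * b + c) \<in> curve h a b \<inter> curve h c d"
    using assms by (auto simp: curve_eq)
  then show ?thesis by blast
qed

section \<open>The shift graph and its strings\<close>

definition shift_pairs :: "nat \<Rightarrow> (nat \<times> nat) set" where
  "shift_pairs n = {(i, j). 1 \<le> i \<and> i < j \<and> j \<le> n}"

text \<open>Height \<open>5 * real n\<close> exceeds every crossing with a hook, as left endpoints
  are at most \<open>n\<close>.\<close>

definition shift_curve :: "nat \<Rightarrow> nat \<times> nat \<Rightarrow> (real^2) set" where
  "shift_curve n = (\<lambda>(i, j). curve (5 * real n) (real i) (real j))"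

lemma finite_shift_pairs: "finite (shift_pairs n)"
  by (rule finite_subset[of _ "{..n} \<times> {..n}"]) (auto simp: shift_pairs_def)

lemma shift_curve_disjoint_iff:
  assumes "(i, j) \<in> shift_pairs n" "(k, l) \<in> shift_pairs n"
  shows "shift_curve n (i, j) \<inter> shift_curve n (k, l) = {} \<longleftrightarrow> j = k \<or> l = i"
proof -
  have succ_le: "real x + 1 \<le> real y" if "x < y" for x y :: nat
    using that by linarith
  have ij: "1 \<le> i" "i < j" "j \<le> n" and kl: "1 \<le> k" "k < l" "l \<le> n"
    using assms by (auto simp: shift_pairs_def)
  consider "j = k" | "l = i" | "i < l" "k < j" | "j < k" | "l < i" by linarith
  then show ?thesis
  proof cases
    case 1
    then show ?thesis
      using ij kl curve_disjoint[of i j l "5 * real n"]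
      by (simp add: shift_curve_def succ_le)
  next
    case 2
    then show ?thesis
      using ij kl curve_disjoint[of k l j "5 * real n"]
      by (auto simp: shift_curve_def Int_commute succ_le)
  next
    case 3
    then show ?thesis
      using ij kl curve_meets_of_overlap[of i j k l "5 * real n"]
      by (auto simp: shift_curve_def succ_le)
  next
    case 4
    then show ?thesis
      using ij kl curve_meets_of_gap[of i j k l "5 * real n"]
      by (auto simp: shift_curve_def succ_le)
  next
    case 5
    then show ?thesis
      using ij kl curve_meets_of_gap[of k l i j "5 * real n"]
      by (auto simp: shift_curve_def succ_le Int_commute)
  qed
qed

lemma shift_colouring_bound:
  assumes range: "c ` shift_pairs n \<subseteq> {..<m}"
    and proper: "\<And>i j k. 1 \<le> i \<Longrightarrow> i < j \<Longrightarrow> j < k \<Longrightarrow> k \<le> n \<Longrightarrow> c (i, j) \<noteq> c (j, k)"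
  shows "n \<le> 2 ^ m"
proof -
  define S where "S i = {c (i, j) | j. i < j \<and> j \<le> n}" for i
  have neq: "S i \<noteq> S j" if "1 \<le> i" "i < j" "j \<le> n" for i j
  proof -
    \<comment> \<open>Membership in \<open>S j\<close> would give some \<open>(j, k)\<close> the
      colour of its neighbour \<open>(i, j)\<close>. For \<open>j = n\<close> the set
      \<open>S j\<close> is empty.\<close>
    have "c (i, j) \<in> S i" "c (i, j) \<notin> S j"
      using that proper by (auto simp: S_def)
    then show ?thesis by blast
  qed
  have "inj_on S {1..n}"
    by (rule linorder_inj_onI) (use neq in auto)
  moreover have "S ` {1..n} \<subseteq> Pow {..<m}"
    using range by (force simp: S_def shift_pairs_def)
  ultimately have "card {1..n} \<le> card (Pow {..<m})"
    by (intro card_inj_on_le) auto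
  then show ?thesis
    by (simp add: card_Pow)
qed

lemma disjointness_edges_iff:
  assumes "A \<in> F" "B \<in> F"
  shows "{A, B} \<in> disjointness_edges F \<longleftrightarrow> A \<noteq> B \<and> A \<inter> B = {}"
  using assms by (auto simp: disjointness_edges_def doubleton_eq_iff)

lemma triangle_free_shift_curves:
  fixes n :: nat
  defines "F \<equiv> shift_curve n ` shift_pairs n"
  shows "triangle_free F (disjointness_edges F)"
  unfolding triangle_free_def
proof
  assume "\<exists>T\<subseteq>F. card T = 3 \<and> clique T (disjointness_edges F)"
  then obtain T where T: "T \<subseteq> F" "card T = 3" "clique T (disjointness_edges F)"
    by blast
  then obtain A B C where ABC: "T = {A, B, C}" "A \<noteq> B" "A \<noteq> C" "B \<noteq> C"
    by (auto simp: card_3_iff)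
  have disj: "A \<inter> B = {}" "A \<inter> C = {}" "B \<inter> C = {}"
    using T(1,3) ABC by (auto simp: clique_def disjointness_edges_iff)
  obtain i j k l r s where ijk: "(i, j) \<in> shift_pairs n" "(k, l) \<in> shift_pairs n"
      "(r, s) \<in> shift_pairs n"
    and eqs: "A = shift_curve n (i, j)" "B = shift_curve n (k, l)" "C = shift_curve n (r, s)"
    using T(1) ABC(1) by (auto simp: F_def)
  have "j = k \<or> l = i" "j = r \<or> s = i" "l = r \<or> s = k"
    using disj ijk by (simp_all add: eqs shift_curve_disjoint_iff)
  moreover have "i < j" "k < l" "r < s"
    using ijk by (auto simp: shift_pairs_def)
  \<comment> \<open>Three pairwise consecutive intervals either follow each other cyclically, or one
    precedes both others; these then start at the same point and cannot be consecutive.\<close>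
  ultimately show False by linarith
qed

lemma shift_curves_chromatic_bound:
  fixes n :: nat
  defines "F \<equiv> shift_curve n ` shift_pairs n"
  assumes "proper_colouring F (disjointness_edges F) m c"
  shows "n \<le> 2 ^ m"
proof (rule shift_colouring_bound)
  show "(c \<circ> shift_curve n) ` shift_pairs n \<subseteq> {..<m}"
    using assms by (auto simp: proper_colouring_def)
next
  fix i j k :: nat
  assume "1 \<le> i" "i < j" "j < k" "k \<le> n"
  then have pairs: "(i, j) \<in> shift_pairs n" "(j, k) \<in> shift_pairs n"
    by (auto simp: shift_pairs_def)
  then have "shift_curve n (i, j) \<inter> shift_curve n (j, k) = {}"
    by (simp add: shift_curve_disjoint_iff)
  \<comment> \<open>Being nonempty, the disjoint curves are distinct, as an edge requires.\<close>
  moreover have "shift_curve n (i, j) \<noteq> {}"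
    by (simp add: shift_curve_def curve_def)
  ultimately have "{shift_curve n (i, j), shift_curve n (j, k)} \<in> disjointness_edges F"
    using pairs by (subst disjointness_edges_iff) (auto simp: F_def)
  then show "(c \<circ> shift_curve n) (i, j) \<noteq> (c \<circ> shift_curve n) (j, k)"
    using assms(2) pairs by (auto simp: proper_colouring_def F_def)
qed

theorem theorem5:
  fixes k :: nat
  assumes "k \<ge> 1"
  shows "\<exists>F :: (real^2) set set. finite F \<and>
           (\<forall>S\<in>F. plane_string S) \<and>
           (\<forall>S\<in>F. simple_polygonal_at_most 4 S) \<and>
           triangle_free F (disjointness_edges F) \<and>
           chromatic_number F (disjointness_edges F) \<ge> enat k"
proof -
  \<comment> \<open>With this \<open>n\<close>, the bound \<open>n \<le> 2 ^ m\<close> becomes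
    \<open>k \<le> m\<close>.\<close>
  define n :: nat where "n = 2 ^ k"
  define F where "F = shift_curve n ` shift_pairs n"
  have polygonal: "\<exists>ps. length ps = 5 \<and> arc (polygonal_path ps) \<and> S = path_image (polygonal_path ps)"
    if "S \<in> F" for S
  proof -
    from that obtain i j where ij: "1 \<le> i" "i < j" "j \<le> n"
        "S = curve (5 * real n) (real i) (real j)"
      by (auto simp: F_def shift_pairs_def shift_curve_def)
    then have "arc (polygonal_path (vertices (5 * real n) (real i) (real j)))"
      by (intro arc_vertices) auto
    moreover have "length (vertices (5 * real n) (real i) (real j)) = 5"
      by (simp add: vertices_def)
    ultimately show ?thesis
      using ij(4) unfolding curve_def by blast
  qed
  show ?thesis
  proof (intro exI[of _ F] conjI ballI)
    show "finite F"
      by (simp add: F_def finite_shift_pairs)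
    show "plane_string S" if "S \<in> F" for S
      using polygonal[OF that] by (auto simp: plane_string_def)
    show "simple_polygonal_at_most 4 S" if "S \<in> F" for S
      using polygonal[OF that] by (force simp: simple_polygonal_at_most_def)
    show "triangle_free F (disjointness_edges F)"
      unfolding F_def by (rule triangle_free_shift_curves)
    show "enat k \<le> chromatic_number F (disjointness_edges F)"
      unfolding chromatic_number_def
    proof (rule INF_greatest)
      fix m
      assume "m \<in> {m. \<exists>c. proper_colouring F (disjointness_edges F) m c}"
      then have "n \<le> 2 ^ m"
        using shift_curves_chromatic_bound unfolding F_def by blast
      then show "enat k \<le> enat m"
        by (simp add: n_def)
    qed
  qed
qed

end
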